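(* Let $s\in(0,1)$ and let $\Omega\subset\mathbb{R}^n$ be a bounded and Lipschitz domain. Then there exists no function $u\in C(\mathbb{R}^n)$ satisfying $$\begin{cases}u(x)=0&\text{for any }x\in\mathbb{R}^n\setminus\Omega\\ \tilde{\mathcal{N}}_su(x)=1&\text{for any }x\in\mathbb{R}^n\setminus\overline{\Omega}.\end{cases}$$
   Context: The renormalized nonlocal normal derivative is $$\tilde{\mathcal{N}}_su(x)=\frac{\int_\Omega\frac{u(x)-u(y)}{|x-y|^{n+2s}}\,dy}{\int_\Omega\frac{dy}{|x-y|^{n+2s}}},\qquad x\in\mathbb{R}^n\setminus\overline{\Omega}.$$ *)

theory Defs
  imports "HOL-Analysis.Analysis"
begin

text \<open>
  Near each boundary point the domain is, in suitable orthonormal coordinates, the region strictly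
  above the graph of a Lipschitz function. The unit vector \<open>\<nu>\<close> is the last coordinate direction,
  the hyperplane \<open>{y. y \<bullet> \<nu> = 0}\<close> plays the role of the space of the remaining coordinates, and
  \<open>x - (x \<bullet> \<nu>) *\<^sub>R \<nu>\<close> is the orthogonal projection of \<open>x\<close> to it. The direction, the function,
  its Lipschitz constant and the radius may all depend on the boundary point. Values of \<open>\<gamma>\<close> off the
  hyperplane are irrelevant.
\<close>

definition lipschitz_domain :: "'a::euclidean_space set \<Rightarrow> bool" where
  "lipschitz_domain \<Omega> \<longleftrightarrow>
     open \<Omega> \<and> connected \<Omega> \<and> \<Omega> \<noteq> {} \<and>
     (\<forall>p\<in>frontier \<Omega>. \<exists>\<nu> \<gamma> L r.
        norm \<nu> = 1 \<and> 0 < r \<and> L-lipschitz_on {y. y \<bullet> \<nu> = 0} \<gamma> \<and>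
        \<Omega> \<inter> ball p r = {x \<in> ball p r. \<gamma> (x - (x \<bullet> \<nu>) *\<^sub>R \<nu>) < x \<bullet> \<nu>})"

definition renormalized_normal_derivative ::
  "real \<Rightarrow> (real ^ 'n) set \<Rightarrow> (real ^ 'n \<Rightarrow> real) \<Rightarrow> real ^ 'n \<Rightarrow> real" where
  "renormalized_normal_derivative s \<Omega> u x =
     (LINT y:\<Omega>|lborel. (u x - u y) / norm (x - y) powr (real CARD('n) + 2 * s)) /
     (LINT y:\<Omega>|lborel. 1 / norm (x - y) powr (real CARD('n) + 2 * s))"

end

theory Submission
  imports Defs
begin

text \<open>
  Let \<open>p\<close> be a boundary point. The Lipschitz graph supplies exterior points \<open>x\<^sub>t = p - t \<nu>\<close>
  and balls of radius \<open>c t\<close> inside the domain at distance at most \<open>3 t\<close> from \<open>x\<^sub>t\<close>, so the total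
  mass over the domain of the kernel \<open>1 / \<bar>x\<^sub>t - y\<bar> powr (n + 2 s)\<close> is at least of order
  \<open>1 / t powr (2 s)\<close>. As it blows up, the normalized kernel concentrates at \<open>p\<close>, and the average
  of \<open>u\<close> that defines the normal derivative at \<open>x\<^sub>t\<close> tends to \<open>u p = 0\<close> rather than staying
  equal to \<open>-1\<close>.
\<close>

section \<open>Geometry of the domain near a boundary point\<close>

lemma norm_minus_inner_scaleR_le:
  fixes v \<nu> :: "'a::real_inner"
  assumes "norm \<nu> = 1"
  shows "norm (v - (v \<bullet> \<nu>) *\<^sub>R \<nu>) \<le> norm v"
proof -
  have "\<nu> \<bullet> \<nu> = 1"
    using assms by (simp add: norm_eq_1)
  then have "(v - (v \<bullet> \<nu>) *\<^sub>R \<nu>) \<bullet> (v - (v \<bullet> \<nu>) *\<^sub>R \<nu>) = v \<bullet> v - (v \<bullet> \<nu>)\<^sup>2"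
    by (simp add: inner_diff inner_commute power2_eq_square)
  also have "\<dots> \<le> v \<bullet> v"
    by simp
  finally show ?thesis
    by (simp add: norm_le)
qed

text \<open>Moving from \<open>p\<close> by \<open>t\<close> along the axis \<nu> opens a gap of
  exactly \<open>t\<close> between the height and the graph. A further displacement \<open>v\<close>
  closes at most \<open>(L + 1) * norm v\<close> of it, so a ball of radius proportional to
  \<open>t\<close> stays on one side of the graph.\<close>

lemma lipschitz_domain_frontier_cone:
  fixes \<Omega> :: "'a::euclidean_space set"
  assumes "lipschitz_domain \<Omega>" and "p \<in> frontier \<Omega>"
  obtains \<nu> c t\<^sub>0 where "norm \<nu> = 1" "0 < c" "c \<le> 1" "0 < t\<^sub>0"
    "\<And>t. 0 < t \<Longrightarrow> t < t\<^sub>0 \<Longrightarrow> p - t *\<^sub>R \<nu> \<notin> closure \<Omega>"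
    "\<And>t. 0 < t \<Longrightarrow> t < t\<^sub>0 \<Longrightarrow> ball (p + t *\<^sub>R \<nu>) (c * t) \<subseteq> \<Omega>"
proof -
  have "open \<Omega>"
    using assms(1) by (simp add: lipschitz_domain_def)
  then have p: "p \<in> closure \<Omega>" "p \<notin> \<Omega>"
    using assms(2) by (auto simp: frontier_def interior_open)
  obtain \<nu> \<gamma> L r where \<nu>: "norm \<nu> = 1" and r: "0 < r"
    and lip: "L-lipschitz_on {y. y \<bullet> \<nu> = 0} \<gamma>"
    and \<Omega>: "\<Omega> \<inter> ball p r = {x \<in> ball p r. \<gamma> (x - (x \<bullet> \<nu>) *\<^sub>R \<nu>) < x \<bullet> \<nu>}"
    using assms unfolding lipschitz_domain_def by blast
  \<comment> \<open>\<open>g\<close> extends the graph function to the whole space, constant along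
    \<nu>. Displacements along the axis therefore cost nothing in the Lipschitz estimate
    below.\<close>
  define g where "g x = \<gamma> (x - (x \<bullet> \<nu>) *\<^sub>R \<nu>)" for x
  have mem: "x \<in> \<Omega> \<longleftrightarrow> g x < x \<bullet> \<nu>" if "x \<in> ball p r" for x
    using \<Omega> that unfolding g_def by blast
  have L: "0 \<le> L"
    using lip by (rule lipschitz_on_nonneg)
  have \<nu>\<nu>: "\<nu> \<bullet> \<nu> = 1"
    using \<nu> by (simp add: norm_eq_1)
  have g: "\<bar>g z - g p\<bar> \<le> L * norm (z - (p + t *\<^sub>R \<nu>))" for z t
  proof -
    let ?v = "z - (p + t *\<^sub>R \<nu>)"
    have "\<bar>g z - g p\<bar> \<le> L * norm ((z - (z \<bullet> \<nu>) *\<^sub>R \<nu>) - (p - (p \<bullet> \<nu>) *\<^sub>R \<nu>))"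
      unfolding g_def dist_norm[symmetric] dist_real_def[symmetric]
      by (rule lipschitz_onD[OF lip]) (simp_all add: inner_diff_left \<nu>\<nu>)
    also have "(z - (z \<bullet> \<nu>) *\<^sub>R \<nu>) - (p - (p \<bullet> \<nu>) *\<^sub>R \<nu>) = ?v - (?v \<bullet> \<nu>) *\<^sub>R \<nu>"
      by (simp add: inner_diff_left inner_add_left \<nu>\<nu> algebra_simps)
    also have "L * norm \<dots> \<le> L * norm ?v"
      using L norm_minus_inner_scaleR_le[OF \<nu>] by (intro mult_left_mono)
    finally show ?thesis .
  qed
  have height: "\<bar>z \<bullet> \<nu> - (p \<bullet> \<nu> + t)\<bar> \<le> norm (z - (p + t *\<^sub>R \<nu>))" for z t
    using Cauchy_Schwarz_ineq2[of "z - (p + t *\<^sub>R \<nu>)" \<nu>]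
    by (simp add: \<nu> \<nu>\<nu> inner_diff_left inner_add_left)
  \<comment> \<open>A boundary point lies on the graph. It is not above it because \<open>p\<close>
    is not in the open set \<Omega>. If it were below, the difference
    \<open>g p - p \<bullet> \<nu>\<close> would persist at all points close enough to
    \<open>p\<close>, which would then avoid \<Omega>.\<close>
  have "g p = p \<bullet> \<nu>"
  proof (rule antisym)
    show "p \<bullet> \<nu> \<le> g p"
      using mem[of p] p r by simp
    show "g p \<le> p \<bullet> \<nu>"
    proof (rule ccontr)
      assume "\<not> ?thesis"
      then have "0 < min r ((g p - p \<bullet> \<nu>) / (L + 1))"
        using r L by simp
      then obtain z where z: "z \<in> \<Omega>" "dist z p < min r ((g p - p \<bullet> \<nu>) / (L + 1))"
        using p(1) unfolding closure_approachable by blast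
      have "(L + 1) * norm (z - p) < g p - p \<bullet> \<nu>"
        using z L by (simp add: dist_norm field_simps)
      moreover have "g z < z \<bullet> \<nu>"
        using mem z by (simp add: dist_commute)
      ultimately show False
        using g[of z 0] height[of z 0] by (simp add: algebra_simps)
    qed
  qed
  \<comment> \<open>The aperture is chosen so that \<open>(L + 1) * c < 1\<close>: the ball of
    radius \<open>c * t\<close> cannot close the gap \<open>t\<close>.\<close>
  define c where "c = 1 / (L + 2)"
  have c: "0 < c" "c \<le> 1" "(L + 1) * c < 1"
    using L by (simp_all add: c_def field_simps)
  \<comment> \<open>The sign of \<sigma> covers both sides of the graph. Since
    \<open>c \<le> 1\<close>, the displacement from \<open>p\<close> is below
    \<open>2 * t < r\<close>, so the graph description applies to \<open>z\<close>.\<close>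
  have near: "z \<in> ball p r" "L * norm v + norm v < t"
    if "0 < t" "t < r / 2" "norm v < c * t" "z = p + \<sigma> *\<^sub>R \<nu> + v" "\<bar>\<sigma>\<bar> = t" for z v t \<sigma>
  proof -
    have "c * t \<le> t"
      using c that by (simp add: mult_left_le_one_le)
    moreover have "norm (\<sigma> *\<^sub>R \<nu> + v) \<le> t + norm v"
      using norm_triangle_ineq[of "\<sigma> *\<^sub>R \<nu>" v] that \<nu> by simp
    moreover have "dist p z = norm (\<sigma> *\<^sub>R \<nu> + v)"
      using that norm_minus_cancel[of "\<sigma> *\<^sub>R \<nu> + v"] by (simp add: dist_norm)
    ultimately have "dist p z < r"
      using that by linarith
    then show "z \<in> ball p r"
      by simp
    have "(L + 1) * norm v \<le> (L + 1) * (c * t)"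
      using that L by (intro mult_left_mono) auto
    also have "\<dots> = ((L + 1) * c) * t"
      by simp
    also have "\<dots> < 1 * t"
      using c that by (intro mult_strict_right_mono) auto
    finally show "L * norm v + norm v < t"
      by (simp add: algebra_simps)
  qed
  show ?thesis
  proof (rule that[OF \<nu> c(1,2), of "r / 2"])
    show "0 < r / 2"
      using r by simp
  next
    fix t :: real
    assume t: "0 < t" "t < r / 2"
    show "ball (p + t *\<^sub>R \<nu>) (c * t) \<subseteq> \<Omega>"
    proof
      fix z
      assume "z \<in> ball (p + t *\<^sub>R \<nu>) (c * t)"
      then have "norm (z - (p + t *\<^sub>R \<nu>)) < c * t"
        by (simp add: dist_norm norm_minus_commute)
      from near[OF t this, of z t] g[of z t] height[of z t] \<open>g p = p \<bullet> \<nu>\<close> t mem[of z]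
      show "z \<in> \<Omega>"
        by simp
    qed
    \<comment> \<open>A whole ball must miss \<Omega> for its centre to lie outside the
      closure.\<close>
    have "z \<notin> \<Omega>" if "dist z (p - t *\<^sub>R \<nu>) < c * t" for z
    proof -
      have "norm (z - (p + (- t) *\<^sub>R \<nu>)) < c * t"
        using that by (simp add: dist_norm)
      from near[OF t this, of z "- t"] g[of z "- t"] height[of z "- t"] \<open>g p = p \<bullet> \<nu>\<close> t mem[of z]
      show ?thesis
        by simp
    qed
    then show "p - t *\<^sub>R \<nu> \<notin> closure \<Omega>"
      using c t unfolding closure_approachable by (metis mult_pos_pos)
  qed
qed

section \<open>Integrability and mass of the kernel\<close>

lemma set_integrable_lborel_bounded:
  fixes f :: "'a::euclidean_space \<Rightarrow> real"
  assumes "open \<Omega>" and "bounded \<Omega>" and "continuous_on \<Omega> f"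
    and "\<And>y. y \<in> \<Omega> \<Longrightarrow> \<bar>f y\<bar> \<le> B"
  shows "set_integrable lborel \<Omega> f"
  unfolding set_integrable_def
proof (rule integrableI_bounded_set[where A = \<Omega> and B = B])
  show "(\<lambda>y. indicat_real \<Omega> y *\<^sub>R f y) \<in> borel_measurable lborel"
    using borel_measurable_continuous_on_indicator[of \<Omega> f] assms by simp
  show "emeasure lborel \<Omega> < \<infinity>"
    using emeasure_bounded_finite[OF assms(2)] by (simp add: top.not_eq_extremum)
qed (use assms in auto)

lemma kernel_le:
  assumes "0 < e" and "e \<le> norm (x - y)" and "0 \<le> a"
  shows "1 / norm (x - y) powr a \<le> 1 / e powr a"
  using assms by (intro divide_left_mono powr_mono2 mult_pos_pos) auto

text \<open>A point outside the closure has a positive distance \<open>e\<close> from \<Omega>, so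
  the singularity is avoided and the kernel is continuous and bounded by
  \<open>1 / e powr a\<close>.\<close>

lemma set_integrable_kernel:
  fixes \<Omega> :: "'a::euclidean_space set"
  assumes "open \<Omega>" and "bounded \<Omega>" and "x \<notin> closure \<Omega>" and "0 \<le> a"
  shows "set_integrable lborel \<Omega> (\<lambda>y. 1 / norm (x - y) powr a)"
proof -
  obtain e where e: "0 < e" "\<And>y. y \<in> \<Omega> \<Longrightarrow> e \<le> norm (x - y)"
    using assms(3) unfolding closure_approachable
    by (metis dist_commute dist_norm not_less)
  show ?thesis
  proof (rule set_integrable_lborel_bounded[OF assms(1,2)])
    show "continuous_on \<Omega> (\<lambda>y. 1 / norm (x - y) powr a)"
      using e by (intro continuous_intros) force+
    show "\<bar>1 / norm (x - y) powr a\<bar> \<le> 1 / e powr a" if "y \<in> \<Omega>" for y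
      using kernel_le[OF e(1) e(2)[OF that] assms(4)] by simp
  qed
qed

text \<open>The kernel is nonnegative, so shrinking the domain to the ball only loses mass, and on
  the ball it is at least \<open>1 / R powr a\<close>.\<close>

lemma kernel_mass_ge_ball:
  fixes \<Omega> :: "'a::euclidean_space set"
  assumes "open \<Omega>" and "bounded \<Omega>" and "x \<notin> closure \<Omega>" and "0 \<le> a"
    and "ball q \<rho> \<subseteq> \<Omega>" and "0 \<le> \<rho>" and "dist x q + \<rho> \<le> R"
  shows "unit_ball_vol (real DIM('a)) * \<rho> ^ DIM('a) / R powr a
    \<le> (LINT y:\<Omega>|lborel. 1 / norm (x - y) powr a)"
proof -
  have int: "set_integrable lborel \<Omega> (\<lambda>y. 1 / norm (x - y) powr a)"
    using assms by (intro set_integrable_kernel)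
  have "unit_ball_vol (real DIM('a)) * \<rho> ^ DIM('a) / R powr a
      = (LINT y:ball q \<rho>|lborel. 1 / R powr a)"
    using assms(6) content_ball[of \<rho> q] emeasure_bounded_finite[of "ball q \<rho>"]
    by (subst set_integral_const) (auto simp: less_top)
  also have "\<dots> \<le> (LINT y:ball q \<rho>|lborel. 1 / norm (x - y) powr a)"
  proof (rule set_integral_mono)
    show "set_integrable lborel (ball q \<rho>) (\<lambda>y. 1 / R powr a)"
      by (intro set_integrable_lborel_bounded[where B = "\<bar>1 / R powr a\<bar>"]) auto
    show "set_integrable lborel (ball q \<rho>) (\<lambda>y. 1 / norm (x - y) powr a)"
      using assms(5) by (intro set_integrable_subset[OF int]) auto
    fix y
    assume y: "y \<in> ball q \<rho>"
    then have "y \<in> closure \<Omega>"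
      using assms(5) closure_subset by blast
    \<comment> \<open>Strict positivity matters: at \<open>y = x\<close> the kernel would take the
      default value \<open>0\<close> and the lower bound would fail.\<close>
    then have "0 < norm (x - y)"
      using assms(3) by auto
    moreover have "norm (x - y) \<le> R"
      using y assms(7) dist_triangle[of x y q] by (simp add: dist_norm)
    ultimately show "1 / R powr a \<le> 1 / norm (x - y) powr a"
      using assms(4) by (intro divide_left_mono powr_mono2 mult_pos_pos) auto
  qed
  also have "\<dots> \<le> (LINT y:\<Omega>|lborel. 1 / norm (x - y) powr a)"
    using assms(5) set_integrable_subset[OF int, of "ball q \<rho>"] int
    unfolding set_lebesgue_integral_def set_integrable_def
    by (intro integral_mono) (auto split: split_indicator)
  finally show ?thesis .
qed

text \<open>The interior ball of radius \<open>c * t\<close> has volume of order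
  \<open>t ^ n\<close> and lies within \<open>3 * t\<close> of the exterior point, where the kernel
  is at least of order \<open>t powr - (n + 2 * s)\<close>. The powers \<open>t ^ n\<close> cancel
  and a negative power of \<open>t\<close> remains.\<close>

lemma kernel_mass_unbounded:
  fixes \<Omega> :: "'a::euclidean_space set"
  assumes "lipschitz_domain \<Omega>" and "bounded \<Omega>" and "p \<in> frontier \<Omega>"
    and "0 < s" and "0 < \<epsilon>"
  obtains x where "x \<notin> closure \<Omega>" "dist x p < \<epsilon>"
    "B < (LINT y:\<Omega>|lborel. 1 / norm (x - y) powr (real DIM('a) + 2 * s))"
proof -
  let ?n = "DIM('a)"
  obtain \<nu> c t\<^sub>0 where \<nu>: "norm \<nu> = 1" and c: "0 < c" "c \<le> 1" and t\<^sub>0: "0 < t\<^sub>0"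
    and ext: "\<And>t. 0 < t \<Longrightarrow> t < t\<^sub>0 \<Longrightarrow> p - t *\<^sub>R \<nu> \<notin> closure \<Omega>"
    and int: "\<And>t. 0 < t \<Longrightarrow> t < t\<^sub>0 \<Longrightarrow> ball (p + t *\<^sub>R \<nu>) (c * t) \<subseteq> \<Omega>"
    using lipschitz_domain_frontier_cone[OF assms(1,3)] by blast
  define D where "D = unit_ball_vol (real ?n) * (c / 3) ^ ?n"
  have D: "0 < D"
    using c by (simp add: D_def)
  \<comment> \<open>The wanted inequality \<open>B < D / (3 * t) powr (2 * s)\<close> is multiplied
    out, so that it becomes a limit equal to \<open>0\<close>, whatever the sign of
    \<open>B\<close>.\<close>
  have "((\<lambda>t. B * (3 * t) powr (2 * s)) \<longlongrightarrow> B * (3 * 0) powr (2 * s)) (at_right 0)"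
    using \<open>0 < s\<close>
    by (intro tendsto_intros tendsto_powr') (auto simp: eventually_at_right_less eventually_at_filter)
  then have "\<forall>\<^sub>F t in at_right 0. B * (3 * t) powr (2 * s) < D"
    using D \<open>0 < s\<close> by (intro order_tendstoD) auto
  moreover have "\<forall>\<^sub>F t in at_right 0. 0 < t \<and> t < min t\<^sub>0 \<epsilon>"
    using t\<^sub>0 \<open>0 < \<epsilon>\<close> eventually_at_right_real[of 0 "min t\<^sub>0 \<epsilon>"] by simp
  ultimately have "\<forall>\<^sub>F t in at_right 0. B * (3 * t) powr (2 * s) < D \<and> 0 < t \<and> t < min t\<^sub>0 \<epsilon>"
    by (rule eventually_conj)
  then obtain t where t: "B * (3 * t) powr (2 * s) < D" "0 < t" "t < t\<^sub>0" "t < \<epsilon>"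
    using eventually_happens'[of "at_right (0::real)"] by auto
  show ?thesis
  proof (rule that)
    show "p - t *\<^sub>R \<nu> \<notin> closure \<Omega>"
      using ext t by blast
    show "dist (p - t *\<^sub>R \<nu>) p < \<epsilon>"
      using t \<nu> by (simp add: dist_norm)
    have "B < D / (3 * t) powr (2 * s)"
      using t by (simp add: field_simps)
    also have "\<dots> = unit_ball_vol (real ?n) * (c * t) ^ ?n / (3 * t) powr (real ?n + 2 * s)"
      using t(2) by (simp add: D_def powr_add powr_realpow power_mult_distrib power_divide)
    also have "\<dots> \<le> (LINT y:\<Omega>|lborel. 1 / norm (p - t *\<^sub>R \<nu> - y) powr (real ?n + 2 * s))"
    proof (rule kernel_mass_ge_ball)
      show "open \<Omega>"
        using assms(1) by (simp add: lipschitz_domain_def)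
      have "p - t *\<^sub>R \<nu> - (p + t *\<^sub>R \<nu>) = - (2 * t) *\<^sub>R \<nu>"
        by (simp add: algebra_simps flip: scaleR_add_left)
      then have "dist (p - t *\<^sub>R \<nu>) (p + t *\<^sub>R \<nu>) = 2 * t"
        using t \<nu> by (simp add: dist_norm)
      then show "dist (p - t *\<^sub>R \<nu>) (p + t *\<^sub>R \<nu>) + c * t \<le> 3 * t"
        using c t by simp
    qed (use assms c t ext int in auto)
    finally show "B < (LINT y:\<Omega>|lborel. 1 / norm (p - t *\<^sub>R \<nu> - y) powr (real ?n + 2 * s))" .
  qed
qed

section \<open>Contradiction from the concentration of the kernel\<close>

theorem theorem6p1:
  fixes s :: real and \<Omega> :: "(real ^ 'n) set"
  assumes "0 < s" and "s < 1"
    and "bounded \<Omega>" and "lipschitz_domain \<Omega>"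
  shows "\<not> (\<exists>u :: real ^ 'n \<Rightarrow> real.
            continuous_on UNIV u \<and>
            (\<forall>x. x \<notin> \<Omega> \<longrightarrow> u x = 0) \<and>
            (\<forall>x. x \<notin> closure \<Omega> \<longrightarrow> renormalized_normal_derivative s \<Omega> u x = 1))"
proof
  assume "\<exists>u :: real ^ 'n \<Rightarrow> real.
            continuous_on UNIV u \<and>
            (\<forall>x. x \<notin> \<Omega> \<longrightarrow> u x = 0) \<and>
            (\<forall>x. x \<notin> closure \<Omega> \<longrightarrow> renormalized_normal_derivative s \<Omega> u x = 1)"
  then obtain u :: "real ^ 'n \<Rightarrow> real" where u: "continuous_on UNIV u"
    and zero: "\<And>x. x \<notin> \<Omega> \<Longrightarrow> u x = 0"
    and one: "\<And>x. x \<notin> closure \<Omega> \<Longrightarrow> renormalized_normal_derivative s \<Omega> u x = 1"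
    by blast
  define a where "a = real CARD('n) + 2 * s"
  have a: "0 \<le> a"
    using \<open>0 < s\<close> by (simp add: a_def)
  have "open \<Omega>" "\<Omega> \<noteq> {}"
    using assms(4) by (simp_all add: lipschitz_domain_def)
  moreover have "\<Omega> \<noteq> UNIV"
    using \<open>bounded \<Omega>\<close> not_bounded_UNIV by blast
  ultimately obtain p where p: "p \<in> frontier \<Omega>"
    using frontier_eq_empty by blast
  then have "u p = 0"
    using \<open>open \<Omega>\<close> by (intro zero) (simp add: frontier_def interior_open)
  obtain M where M: "\<And>y. y \<in> \<Omega> \<Longrightarrow> \<bar>u y\<bar> \<le> M" "0 < M"
  proof -
    have "bounded (u ` closure \<Omega>)"
      using u \<open>bounded \<Omega>\<close>
      by (intro compact_imp_bounded compact_continuous_image) (auto intro: continuous_on_subset)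
    then obtain M where "0 < M" "\<And>y. y \<in> closure \<Omega> \<Longrightarrow> \<bar>u y\<bar> \<le> M"
      by (auto simp: bounded_pos)
    then show ?thesis
      using that closure_subset by blast
  qed
  obtain \<delta> where \<delta>: "0 < \<delta>" "\<And>y. dist y p < \<delta> \<Longrightarrow> \<bar>u y\<bar> < 1 / 2"
    using u \<open>u p = 0\<close> unfolding continuous_on_iff
    by (metis UNIV_I diff_zero dist_real_def half_gt_zero zero_less_one)
  define K where "K = M / (\<delta> / 2) powr a"
  \<comment> \<open>Points at distance at least \<delta> from \<open>p\<close> are then at least
    \<open>\<delta> / 2\<close> from \<open>x\<close>, so \<open>K\<close> bounds the integrand
    there. The mass is taken so large that half of it exceeds the integral of
    \<open>K\<close>.\<close>
  obtain x where x: "x \<notin> closure \<Omega>" "dist x p < \<delta> / 2"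
    and mass: "2 * (K * measure lborel \<Omega>) < (LINT y:\<Omega>|lborel. 1 / norm (x - y) powr a)"
    using kernel_mass_unbounded[OF assms(4,3) p \<open>0 < s\<close>, of "\<delta> / 2"] \<delta>
    unfolding a_def by (metis DIM_cart DIM_real half_gt_zero mult.right_neutral)
  let ?w = "\<lambda>y. 1 / norm (x - y) powr a"
  have w: "set_integrable lborel \<Omega> ?w"
    using set_integrable_kernel \<open>open \<Omega>\<close> \<open>bounded \<Omega>\<close> x(1) a by blast
  have K: "set_integrable lborel \<Omega> (\<lambda>y. K)"
    using \<open>open \<Omega>\<close> \<open>bounded \<Omega>\<close> by (intro set_integrable_lborel_bounded[where B = "\<bar>K\<bar>"]) auto
  have "u x = 0"
    using x(1) closure_subset by (intro zero) blast
  \<comment> \<open>The first summand handles \<open>y\<close> near \<open>p\<close>, where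
    \<open>u\<close> is below \<open>1 / 2\<close> in absolute value; the second handles the rest of
    \<Omega>.\<close>
  have bound: "\<bar>(u x - u y) / norm (x - y) powr a\<bar> \<le> ?w y / 2 + K" if "y \<in> \<Omega>" for y
  proof (cases "dist y p < \<delta>")
    case True
    then have "\<bar>u y\<bar> * ?w y \<le> 1 / 2 * ?w y"
      using \<delta>(2) by (intro mult_right_mono) (auto intro: less_imp_le)
    moreover have "0 \<le> K"
      using M by (simp add: K_def)
    ultimately show ?thesis
      using \<open>u x = 0\<close> by (simp add: abs_divide)
  next
    case False
    then have "\<delta> / 2 \<le> norm (x - y)"
      using x(2) dist_triangle[of y p x] by (simp add: dist_norm norm_minus_commute)
    then have "?w y \<le> 1 / (\<delta> / 2) powr a"
      using \<delta>(1) a by (intro kernel_le) auto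
    then have "\<bar>u y\<bar> * ?w y \<le> M * (1 / (\<delta> / 2) powr a)"
      using M that by (intro mult_mono) auto
    then have "\<bar>(u x - u y) / norm (x - y) powr a\<bar> \<le> K"
      using \<open>u x = 0\<close> by (simp add: abs_divide K_def)
    then show ?thesis
      by (intro add_increasing) auto
  qed
  have rhs: "set_integrable lborel \<Omega> (\<lambda>y. ?w y / 2 + K)"
    using w K by (intro set_integral_add set_integrable_divide)
  \<comment> \<open>A quotient equal to \<open>1\<close> has equal numerator and denominator;
    division by zero would give \<open>0\<close>.\<close>
  have "(LINT y:\<Omega>|lborel. ?w y) = (LINT y:\<Omega>|lborel. (u x - u y) / norm (x - y) powr a)"
    using one[OF x(1)] by (simp add: renormalized_normal_derivative_def a_def divide_eq_1_iff)
  also have "\<dots> \<le> (LINT y:\<Omega>|lborel. ?w y / 2 + K)"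
  proof (rule set_integral_mono[OF _ rhs])
    have "y \<noteq> x" if "y \<in> \<Omega>" for y
      using that x(1) closure_subset by blast
    then have "continuous_on \<Omega> (\<lambda>y. (u x - u y) / norm (x - y) powr a)"
      using u by (intro continuous_intros) (auto intro: continuous_on_subset)
    from borel_measurable_continuous_on_indicator[OF borel_open[OF \<open>open \<Omega>\<close>] this]
    have "set_borel_measurable lborel \<Omega> (\<lambda>y. (u x - u y) / norm (x - y) powr a)"
      by (simp add: set_borel_measurable_def)
    with rhs show "set_integrable lborel \<Omega> (\<lambda>y. (u x - u y) / norm (x - y) powr a)"
      by (rule set_integrable_bound) (use bound in \<open>auto intro!: AE_I2 intro: order_trans[OF _ abs_ge_self]\<close>)
  qed (rule abs_le_D1[OF bound])
  also have "\<dots> = (LINT y:\<Omega>|lborel. ?w y / 2) + (LINT y:\<Omega>|lborel. K)"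
    using w K by (intro set_integral_add set_integrable_divide)
  also have "(LINT y:\<Omega>|lborel. ?w y / 2) = (LINT y:\<Omega>|lborel. ?w y) / 2"
    by (rule set_integral_divide_zero)
  also have "(LINT y:\<Omega>|lborel. K) = K * measure lborel \<Omega>"
    using emeasure_bounded_finite[OF \<open>bounded \<Omega>\<close>] \<open>open \<Omega>\<close>
    by (subst set_integral_const) (auto simp: less_top)
  \<comment> \<open>The chain says that the mass is at most half of itself plus
    \<open>K * measure lborel \<Omega>\<close>, against the choice of \<open>x\<close>.\<close>
  finally show False
    using mass by simp
qed

end
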